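(* Let $N\ge 2$ be an integer and let $\mathbf v=(v_0,\dots,v_{N-1})$ be a real vector with null mean, i.e. $\sum_{n=0}^{N-1}v_n=0$, with DCT spectrum $V_0,\dots,V_{N-1}$. Let $\beta$ be a fixed real number with $\cos(2\pi\beta)\ne 0$, put $a_n=\cos(2\pi n\beta)$ for $n=1,2,3,\ldots$, and let $\{b_n\}_{n\ge 1}$ be the Dirichlet inverse of $\{a_n\}_{n\ge1}$. Let $S_k$, $k=1,\dots,N-1$, be the ACT averages of $\mathbf v$ with parameter $\beta$. Then $$V_k=\sqrt{\frac N2}\sum_{l=1}^{\left\lfloor\frac{N-1}{k}\right\rfloor} b_l\,S_{kl},\qquad k=1,2,\ldots,N-1.$$
   Context: The DCT spectrum of $\mathbf v=(v_0,\dots,v_{N-1})$ is $$V_k=\sqrt{\tfrac2N}\,\alpha_k\sum_{n=0}^{N-1}v_n\cos\left(\frac{\pi k(n+1/2)}{N}\right),\quad k=0,\dots,N-1,$$ where $\alpha_0=1/\sqrt2$ and $\alpha_k=1$ for $k\ge1$. For any real number $r$, the (possibly fractional index) sample $v_r$ is defined by extending the inverse DCT formula to noninteger indices: $$v_r=\sqrt{\tfrac2N}\sum_{k=0}^{N-1}\alpha_kV_k\cos\left(\frac{\pi k(r+1/2)}{N}\right).$$ For a fixed real $\beta$, the $k$th ACT average is $$S_k=\frac1k\sum_{m=0}^{k-1}v_{2(m+\beta)\frac Nk-\frac12},\quad k=1,\dots,N-1.$$ The Dirichlet inverse of a sequence $\{a_n\}_{n\ge1}$ with $a_1\neq0$ is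 the unique sequence $\{b_n\}_{n\ge1}$ with $\sum_{d\mid n}a_d\,b_{n/d}=1$ if $n=1$ and $=0$ if $n>1$. *)

theory Defs
  imports "HOL-Analysis.Analysis"
begin

(* A vector (v_0, ..., v_{N-1}) is a function v :: nat => real together with its
   length N; only the values v n with n < N are ever used. *)

definition dct_alpha :: "nat \<Rightarrow> real" where
  "dct_alpha k = (if k = 0 then 1 / sqrt 2 else 1)"

definition dct :: "nat \<Rightarrow> (nat \<Rightarrow> real) \<Rightarrow> nat \<Rightarrow> real" where
  "dct N v k = sqrt (2 / real N) * dct_alpha k *
     (\<Sum>n<N. v n * cos (pi * real k * (real n + 1 / 2) / real N))"

definition sample :: "nat \<Rightarrow> (nat \<Rightarrow> real) \<Rightarrow> real \<Rightarrow> real" where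
  "sample N v r = sqrt (2 / real N) *
     (\<Sum>k<N. dct_alpha k * dct N v k * cos (pi * real k * (r + 1 / 2) / real N))"

definition act_average :: "real \<Rightarrow> nat \<Rightarrow> (nat \<Rightarrow> real) \<Rightarrow> nat \<Rightarrow> real" where
  "act_average \<beta> N v k = 1 / real k *
     (\<Sum>m<k. sample N v (2 * (real m + \<beta>) * (real N / real k) - 1 / 2))"

(* Sequences indexed by n >= 1 are functions on nat whose value at 0 is irrelevant.
   Hence "b is the inverse of a" is a relation; if a 1 is nonzero, such a b exists and
   is unique on the positive integers (lemmas below). *)

definition is_dirichlet_inverse :: "(nat \<Rightarrow> real) \<Rightarrow> (nat \<Rightarrow> real) \<Rightarrow> bool" where
  "is_dirichlet_inverse a b \<longleftrightarrow>
     (\<forall>n\<ge>1. (\<Sum>d | d dvd n. a d * b (n div d)) = (if n = 1 then 1 else 0))"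

lemma sum_divisors_split:
  fixes a b :: "nat \<Rightarrow> real"
  assumes "n \<ge> 1"
  shows "(\<Sum>d | d dvd n. a d * b (n div d)) =
    a 1 * b n + (\<Sum>d | d dvd n \<and> d > 1. a d * b (n div d))"
proof -
  have "{d. d dvd n} = insert 1 {d. d dvd n \<and> d > 1}"
    using assms by (auto intro!: Nat.gr0I simp: not_less le_Suc_eq)
  moreover have "finite {d. d dvd n \<and> d > 1}"
    by (rule finite_subset[OF _ finite_divisors_nat[of n]]) (use assms in auto)
  ultimately show ?thesis by simp
qed

lemma dirichlet_inverse_exists:
  fixes a :: "nat \<Rightarrow> real"
  assumes "a 1 \<noteq> 0"
  shows "\<exists>b. is_dirichlet_inverse a b"
proof -
  define F where "F = (\<lambda>(b :: nat \<Rightarrow> real) n.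
    ((if n = 1 then 1 else 0) - (\<Sum>d | d dvd n \<and> d > 1. a d * b (n div d))) / a 1)"
  define b where "b = wfrec less_than (\<lambda>b n. if n = 0 then 0 else F b n)"
  have b: "b n = F b n" if "n \<ge> 1" for n
  proof -
    have "b n = F (cut b less_than n) n"
      using that unfolding b_def by (subst wfrec[OF wf_less_than]) simp
    also have "\<dots> = F b n"
      unfolding F_def using that
      by (intro arg_cong2[where f = "(/)"] arg_cong2[where f = "(-)"] sum.cong)
         (auto simp: cut_apply)
    finally show ?thesis .
  qed
  have "is_dirichlet_inverse a b"
    unfolding is_dirichlet_inverse_def
  proof (intro allI impI)
    fix n :: nat assume n: "n \<ge> 1"
    show "(\<Sum>d | d dvd n. a d * b (n div d)) = (if n = 1 then 1 else 0)"
      unfolding sum_divisors_split[OF n]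
      using b[OF n] assms by (simp add: F_def field_simps)
  qed
  then show ?thesis by blast
qed

lemma dirichlet_inverse_unique:
  fixes a b c :: "nat \<Rightarrow> real"
  assumes "a 1 \<noteq> 0" "is_dirichlet_inverse a b" "is_dirichlet_inverse a c" "n \<ge> 1"
  shows "b n = c n"
  using assms(4)
proof (induction n rule: less_induct)
  case (less n)
  have "b (n div d) = c (n div d)" if "d dvd n" "d > 1" for d
    using that less.prems by (intro less.IH) (auto simp: Suc_le_eq dvd_div_eq_0_iff)
  then have "(\<Sum>d | d dvd n \<and> d > 1. a d * b (n div d)) =
             (\<Sum>d | d dvd n \<and> d > 1. a d * c (n div d))"
    by (intro sum.cong) auto
  moreover have "(\<Sum>d | d dvd n. a d * b (n div d)) = (\<Sum>d | d dvd n. a d * c (n div d))"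
    using assms(2,3) less.prems by (simp add: is_dirichlet_inverse_def)
  ultimately have "a 1 * b n = a 1 * c n"
    using sum_divisors_split[OF less.prems, of a b] sum_divisors_split[OF less.prems, of a c]
    by linarith
  then show ?case using assms(1) by simp
qed

end

theory Submission
  imports Defs
begin

text \<open>
  At the sampling points used by \<^const>\<open>act_average\<close> the spacing \<open>2 N / k\<close> makes the length
  \<open>N\<close> cancel: the \<open>j\<close>-th cosine of the inverse DCT is evaluated at the angle
  \<open>2 \<pi> j (m + \<beta>) / k\<close>.  Averaging over \<open>m < k\<close> thus averages over equally spaced points of the
  circle, which kills every frequency \<open>j\<close> not divisible by \<open>k\<close>, while a frequency \<open>j = k q\<close> is
  constant in \<open>m\<close> and survives with the factor \<open>a\<^sub>q = cos (2 \<pi> q \<beta>)\<close>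
  (\<open>sum_cos_equally_spaced\<close>).  The null mean says \<open>V\<^sub>0 = 0\<close>, so
  \<open>sqrt (N/2) S\<^sub>k = (\<Sum>q. a\<^sub>q V\<^bsub>kq\<^esub>)\<close> over the \<open>q \<ge> 1\<close> with \<open>k q \<le> N - 1\<close>
  (\<open>act_average_eq\<close>).

  A system of this shape, a sum over multiples up to a bound, is undone by the Dirichlet inverse
  of the coefficients (\<open>dirichlet_inversion_multiples\<close>): substituting one sum into the other and
  collecting the terms with the same product \<open>n = l q\<close> leaves the Dirichlet convolution of \<open>a\<close>
  and \<open>b\<close> as the coefficient of \<open>V\<^bsub>kn\<^esub>\<close>.
\<close>

text \<open>Both sides run over the pairs of positive integers with product at most \<open>M\<close>; on the right
  they are grouped by their product.\<close>

lemma sum_pairs_eq_sum_divisors: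
  fixes f :: "nat \<Rightarrow> nat \<Rightarrow> 'a :: comm_monoid_add"
  shows "(\<Sum>l = 1..M. \<Sum>q = 1..M div l. f l q) =
         (\<Sum>n = 1..M. \<Sum>d | d dvd n. f (n div d) d)"
proof -
  have "(\<Sum>l = 1..M. \<Sum>q = 1..M div l. f l q) =
        (\<Sum>(l, q) \<in> (SIGMA l:{1..M}. {1..M div l}). f l q)"
    by (rule sum.Sigma) auto
  also have "\<dots> = (\<Sum>(n, d) \<in> (SIGMA n:{1..M}. {d. d dvd n}). f (n div d) d)"
  proof (rule sum.reindex_bij_witness[where
        i = "\<lambda>(n, d). (n div d, d)" and j = "\<lambda>(l, q). (l * q, q)"], goal_cases)
    case (2 x)
    then obtain l q where x: "x = (l, q)" "1 \<le> l" "1 \<le> q" "q \<le> M div l"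
      by auto
    then have "l * q \<le> M"
      by (metis mult_le_mono2 order_trans times_div_less_eq_dividend)
    then show ?case using x by auto
  next
    case (4 y)
    then obtain n d where y: "y = (n, d)" "1 \<le> n" "n \<le> M" "d dvd n"
      by auto
    then obtain e where e: "n = d * e" by (auto simp: dvd_def)
    have pos: "d > 0" "e > 0" using y e by (auto intro!: Nat.gr0I)
    have "e \<le> n" using y e by (intro dvd_imp_le) auto
    then have "e \<le> M" using y by simp
    moreover have "d \<le> M div e"
      using y e pos by (simp add: less_eq_div_iff_mult_less_eq)
    ultimately show ?case using y e pos by auto
  qed auto
  also have "\<dots> = (\<Sum>n = 1..M. \<Sum>d | d dvd n. f (n div d) d)"
    by (rule sum.Sigma[symmetric]) auto
  finally show ?thesis .
qed

text \<open>With \<open>a = 1\<close> and \<open>b\<close> the Moebius function this is the classical Moebius inversion over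
  multiples.\<close>

lemma dirichlet_inversion_multiples:
  fixes a b f g :: "nat \<Rightarrow> real"
  assumes inv: "is_dirichlet_inverse a b"
    and g: "\<And>k. 1 \<le> k \<Longrightarrow> k \<le> M \<Longrightarrow> g k = (\<Sum>q = 1..M div k. a q * f (k * q))"
    and k: "1 \<le> k" "k \<le> M"
  shows "(\<Sum>l = 1..M div k. b l * g (k * l)) = f k"
proof -
  have "b l * g (k * l) =
      (\<Sum>q = 1..(M div k) div l. b l * a q * f (k * (l * q)))" if l: "l \<in> {1..M div k}" for l
  proof -
    have "k * l \<le> M"
      using l by (metis atLeastAtMost_iff mult_le_mono2 order_trans times_div_less_eq_dividend)
    then have "g (k * l) = (\<Sum>q = 1..M div (k * l). a q * f (k * l * q))"
      using k l by (intro g) auto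
    then show ?thesis
      by (simp add: div_mult2_eq sum_distrib_left mult.assoc)
  qed
  then have "(\<Sum>l = 1..M div k. b l * g (k * l)) =
      (\<Sum>l = 1..M div k. \<Sum>q = 1..(M div k) div l. b l * a q * f (k * (l * q)))"
    by (intro sum.cong) auto
  also have "\<dots> = (\<Sum>n = 1..M div k. \<Sum>d | d dvd n. b (n div d) * a d * f (k * (n div d * d)))"
    by (rule sum_pairs_eq_sum_divisors)
  also have "\<dots> = (\<Sum>n = 1..M div k. (\<Sum>d | d dvd n. a d * b (n div d)) * f (k * n))"
    by (simp add: sum_distrib_left sum_distrib_right mult_ac)
  also have "\<dots> = (\<Sum>n = 1..M div k. if n = 1 then f (k * n) else 0)"
    using inv unfolding is_dirichlet_inverse_def by (intro sum.cong) auto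
  also have "\<dots> = f k"
    using k by (simp add: div_greater_zero_iff Suc_le_eq)
  finally show ?thesis .
qed

text \<open>If \<open>k\<close> does not divide \<open>j\<close>, multiplying by \<open>2 sin (\<pi> j / k)\<close>, which is then nonzero, makes
  the sum telescope over a full number of periods.  If \<open>j = k q\<close>, every angle agrees with
  \<open>2 \<pi> q \<beta>\<close> up to a full number of turns.\<close>

lemma sum_cos_equally_spaced:
  fixes \<beta> :: real
  assumes k: "k > 0"
  shows "(\<Sum>m<k. cos (2 * pi * real j * (real m + \<beta>) / real k)) =
         (if k dvd j then real k * cos (2 * pi * real (j div k) * \<beta>) else 0)"
proof (cases "k dvd j")
  case True
  then obtain q where q: "j = k * q" by (auto simp: dvd_def)
  have "cos (2 * pi * real j * (real m + \<beta>) / real k) = cos (2 * pi * real q * \<beta>)" for m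
  proof -
    have "2 * pi * real j * (real m + \<beta>) / real k =
        2 * pi * real q * \<beta> + real (q * m) * (2 * pi)"
      using k q by (simp add: field_simps)
    then show ?thesis
      using cos.plus_of_nat[of "2 * pi * real q * \<beta>" "q * m"] by simp
  qed
  then show ?thesis using True q k by simp
next
  case False
  define x where "x = 2 * pi * real j / real k"
  define F where "F = (\<lambda>m :: nat. sin (x * (real m + \<beta>) - x / 2))"
  have "2 * sin (x / 2) * (\<Sum>m<k. cos (2 * pi * real j * (real m + \<beta>) / real k)) =
      (\<Sum>m<k. F (Suc m) - F m)"
    unfolding sum_distrib_left
  proof (rule sum.cong[OF refl])
    fix m
    have "F (Suc m) = sin (x * (real m + \<beta>) + x / 2)"
      unfolding F_def by (rule arg_cong[where f = sin]) (simp add: field_simps)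
    moreover have "2 * pi * real j * (real m + \<beta>) / real k = x * (real m + \<beta>)"
      by (simp add: x_def)
    ultimately show "2 * sin (x / 2) * cos (2 * pi * real j * (real m + \<beta>) / real k) =
        F (Suc m) - F m"
      by (simp add: F_def sin_add sin_diff)
  qed
  also have "\<dots> = F k - F 0" by (rule sum_lessThan_telescope)
  also have "F k = F 0"
  proof -
    have "x * (real k + \<beta>) - x / 2 = (x * \<beta> - x / 2) + real j * (2 * pi)"
      using k by (simp add: x_def field_simps)
    then have "F k = sin (x * \<beta> - x / 2 + real j * (2 * pi))"
      unfolding F_def by (rule arg_cong)
    also have "\<dots> = sin (x * \<beta> - x / 2)"
      using sin.plus_of_nat[of "x * \<beta> - x / 2" j] by simp
    finally show ?thesis
      by (simp add: F_def)
  qed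
  finally have "sin (x / 2) * (\<Sum>m<k. cos (2 * pi * real j * (real m + \<beta>) / real k)) = 0"
    by simp
  moreover have "sin (x / 2) \<noteq> 0"
  proof
    assume "sin (x / 2) = 0"
    then obtain i :: int where "x / 2 = real_of_int i * pi"
      by (auto simp: sin_zero_iff_int2)
    then have "pi * real j = pi * (real_of_int i * real k)"
      using k by (simp add: x_def field_simps)
    then have "real_of_int (int j) = real_of_int (i * int k)"
      by simp
    then have "int j = i * int k" by (simp only: of_int_eq_iff)
    then have "int k dvd int j" by simp
    then show False using False by simp
  qed
  ultimately show ?thesis using False by simp
qed

lemma dct_0_eq_0:
  assumes "(\<Sum>n<N. v n) = 0"
  shows "dct N v 0 = 0"
  using assms by (simp add: dct_def)

lemma act_average_eq:
  assumes N: "N \<ge> 1" and mean: "(\<Sum>n<N. v n) = 0" and k: "k \<ge> 1"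
  shows "sqrt (real N / 2) * act_average \<beta> N v k =
         (\<Sum>q = 1..(N - 1) div k. cos (2 * pi * real q * \<beta>) * dct N v (k * q))"
proof -
  define c where "c = (\<lambda>j. dct_alpha j * dct N v j)"
  have c0: "c 0 = 0" using mean by (simp add: c_def dct_0_eq_0)
  have angle: "pi * real j * (2 * (real m + \<beta>) * (real N / real k) - 1 / 2 + 1 / 2) / real N =
      2 * pi * real j * (real m + \<beta>) / real k" for j m
    using N by simp
  have scale: "sqrt (real N / 2) * sqrt (2 / real N) = 1"
    using N by (simp flip: real_sqrt_mult)
  have "sqrt (real N / 2) * act_average \<beta> N v k =
      (sqrt (real N / 2) * sqrt (2 / real N)) * (1 / real k *
        (\<Sum>m<k. \<Sum>j<N. c j * cos (2 * pi * real j * (real m + \<beta>) / real k)))"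
    unfolding act_average_def sample_def angle c_def
    by (simp add: sum_distrib_left[symmetric])
  also have "\<dots> = 1 / real k *
      (\<Sum>j<N. c j * (\<Sum>m<k. cos (2 * pi * real j * (real m + \<beta>) / real k)))"
    unfolding scale by (subst sum.swap) (simp add: sum_distrib_left)
  also have "\<dots> = (\<Sum>j<N. if k dvd j then c j * cos (2 * pi * real (j div k) * \<beta>) else 0)"
    using k by (auto simp: sum_cos_equally_spaced sum_distrib_left intro!: sum.cong)
  also have "\<dots> = (\<Sum>j | j < N \<and> k dvd j \<and> j > 0. c j * cos (2 * pi * real (j div k) * \<beta>))"
    using c0 by (intro sum.mono_neutral_cong_right) (auto intro!: Nat.gr0I)
  also have "\<dots> = (\<Sum>q = 1..(N - 1) div k. cos (2 * pi * real q * \<beta>) * dct N v (k * q))"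
  proof (rule sum.reindex_bij_witness[where i = "\<lambda>q. k * q" and j = "\<lambda>j. j div k"], goal_cases)
    case (2 j)
    then show ?case using k by (auto simp: dvd_def less_eq_div_iff_mult_less_eq mult.commute)
  next
    case (4 q)
    then have "k * q \<le> N - 1"
      by (metis atLeastAtMost_iff mult_le_mono2 order_trans times_div_less_eq_dividend)
    then show ?case using k N 4 by auto
  next
    case (5 j)
    then show ?case by (auto simp: c_def dct_alpha_def)
  qed (use k in auto)
  finally show ?thesis .
qed

theorem mainTheorem1:
  fixes N :: nat and v :: "nat \<Rightarrow> real" and \<beta> :: real and b :: "nat \<Rightarrow> real"
  assumes "N \<ge> 2"
    and "(\<Sum>n<N. v n) = 0"
    and "cos (2 * pi * \<beta>) \<noteq> 0"
    and "is_dirichlet_inverse (\<lambda>n. cos (2 * pi * real n * \<beta>)) b"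
  shows "\<forall>k\<in>{1..N - 1}.
    dct N v k = sqrt (real N / 2) *
      (\<Sum>l = 1..nat \<lfloor>(real N - 1) / real k\<rfloor>. b l * act_average \<beta> N v (k * l))"
proof
  fix k assume k: "k \<in> {1..N - 1}"
  have "(real N - 1) / real k = real (N - 1) / real k"
    using assms(1) by (simp add: of_nat_diff)
  then have upper: "nat \<lfloor>(real N - 1) / real k\<rfloor> = (N - 1) div k"
    by (simp only: floor_divide_of_nat_eq nat_int)
  have "(\<Sum>l = 1..(N - 1) div k. b l * (sqrt (real N / 2) * act_average \<beta> N v (k * l))) =
      dct N v k"
    using k assms(1,2)
    by (intro dirichlet_inversion_multiples[OF assms(4),
          where g = "\<lambda>k. sqrt (real N / 2) * act_average \<beta> N v k"] act_average_eq) auto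
  then show "dct N v k = sqrt (real N / 2) *
      (\<Sum>l = 1..nat \<lfloor>(real N - 1) / real k\<rfloor>. b l * act_average \<beta> N v (k * l))"
    unfolding upper by (simp add: sum_distrib_left mult.left_commute)
qed

end
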